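(* For every $n\ge 3$, the induced greedy colex process for the butterfly poset $\bowtie$ on ground set $[n]$ outputs exactly the family $\mathcal H_n$. In particular, $\mathrm{sat}^*(n,\bowtie)\le 6n-10$.
   Context: The butterfly $\bowtie$ is the poset on four elements $a,b,c,d$ with $a<c$, $a<d$, $b<c$, $b<d$ and no other relations. A subfamily $\mathcal G\subseteq\mathcal F\subseteq 2^{[n]}$ is an induced copy of a poset $P$ if there is a bijection $i:P\to\mathcal G$ with $p\le_P q$ iff $i(p)\subseteq i(q)$; $\mathcal F$ is induced $P$-saturating if it has no induced copy of $P$ and adding any $G\in2^{[n]}\setminus\mathcal F$ creates one; $\mathrm{sat}^*(n,P)$ is the minimum size of such a family. Colex order: $A<B$ iff $\max(A\triangle B)\in B$. Induced greedy colex process for $P$ on $[n]$: enumerate $2^{[n-1]}$ in colex order as $F_1,\dots,F_{2^{n-1}}$, let $G_i=[n]\setminus F_i$, start with $\mathcal F_0=\emptyset$; for $i=1,\dots,2^{n-1}$, first add $F_i$ to the current family if the result has no induced copy of $P$, then add $G_i$ if the result has no induced copy of $P$; the resulting family is $\mathcal F_i$, and the output is $\mathcal F_{2^{n-1}}$. Define $\mathcal T_1=\{\emptyset\}$, $\mathcal T_2=\{\{1\},\{2\},\{1,2\}\}$, $\mathcal T_3=\{\{3\},\{1,3\},\{2,3\}\}$, and for $k\ge2$: $\mathcal T_{2k}=\{\{1,4,6,\dots,2k\},\{2,4,6,\dots,2k\},\{1,2,4,6,\dots,2k\}\}$ and $\mathcal T_{2k+1}=\{\{3,5,\dots,2k+1\},\{1,3,5,\dots,2k+1\},\{2,3,5,\dots,2k+1\}\}$.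 For $1\le j<n$ let $\mathcal T_{j,n}=\{[n]\setminus T: T\in\mathcal T_j\}$, and $\mathcal H_n=\bigcup_{j=1}^{n-1}(\mathcal T_j\cup\mathcal T_{j,n})$. *)

theory Defs
  imports Main
begin

text \<open>
  A finite poset is a reflexive order relation \<open>r\<close> (in the sense of \<^theory>\<open>HOL.Order_Relation\<close>);
  its ground set is \<^term>\<open>Field r\<close>.
\<close>

definition induced_copy :: "'p rel \<Rightarrow> 'a set set \<Rightarrow> bool" where
  "induced_copy r G \<longleftrightarrow>
     (\<exists>i. bij_betw i (Field r) G \<and>
          (\<forall>p\<in>Field r. \<forall>q\<in>Field r. (p, q) \<in> r \<longleftrightarrow> i p \<subseteq> i q))"

definition has_induced_copy :: "'p rel \<Rightarrow> 'a set set \<Rightarrow> bool" where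
  "has_induced_copy r F \<longleftrightarrow> (\<exists>G\<subseteq>F. induced_copy r G)"

definition induced_saturating :: "nat \<Rightarrow> 'p rel \<Rightarrow> nat set set \<Rightarrow> bool" where
  "induced_saturating n r F \<longleftrightarrow>
     F \<subseteq> Pow {1..n} \<and> \<not> has_induced_copy r F \<and>
     (\<forall>G\<in>Pow {1..n} - F. has_induced_copy r (insert G F))"

definition sat_star :: "nat \<Rightarrow> 'p rel \<Rightarrow> nat" where
  "sat_star n r = (LEAST m. \<exists>F. induced_saturating n r F \<and> card F = m)"

datatype butterfly_elem = Elem_a | Elem_b | Elem_c | Elem_d

definition butterfly :: "butterfly_elem rel" where
  "butterfly = Id \<union> {Elem_a, Elem_b} \<times> {Elem_c, Elem_d}"

lemma Field_butterfly: "Field butterfly = UNIV"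
  by (auto simp: butterfly_def Field_def)

lemma Partial_order_butterfly: "Partial_order butterfly"
  unfolding Field_butterfly
  by (auto simp: partial_order_on_def preorder_on_def refl_on_def trans_def antisym_def
      butterfly_def)

text \<open>Colex order, to be used on finite sets only.\<close>

definition colex_less :: "nat set \<Rightarrow> nat set \<Rightarrow> bool" where
  "colex_less A B \<longleftrightarrow> A \<noteq> B \<and> Max (sym_diff A B) \<in> B"

definition colex_enum :: "nat \<Rightarrow> nat set list" where
  "colex_enum m = (THE xs. sorted_wrt colex_less xs \<and> set xs = Pow {1..m})"

text \<open>The definite description in \<^const>\<open>colex_enum\<close> is proper:\<close>

lemma colex_less_asym:
  assumes "colex_less A B" "finite A" "finite B"
  shows "\<not> colex_less B A"
proof
  assume BA: "colex_less B A"
  have "Max (sym_diff A B) \<in> sym_diff A B"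
    using assms by (intro Max_in) (auto simp: colex_less_def)
  with assms(1) BA show False
    by (auto simp: colex_less_def Un_commute)
qed

lemma sorted_wrt_asym_unique:
  assumes "sorted_wrt R xs" "sorted_wrt R ys" "set xs = set ys"
    and "\<And>a b. a \<in> set xs \<Longrightarrow> b \<in> set xs \<Longrightarrow> R a b \<Longrightarrow> \<not> R b a"
  shows "xs = ys"
  using assms
proof (induction xs arbitrary: ys)
  case Nil
  then show ?case by simp
next
  case (Cons x xs)
  obtain y zs where ys: "ys = y # zs" using Cons.prems(3) by (cases ys) auto
  have xy: "x = y"
  proof (rule ccontr)
    assume "x \<noteq> y"
    with Cons.prems(3) ys have "x \<in> set zs" and y: "y \<in> set xs" by auto
    with Cons.prems(1,2) ys have "R y x" "R x y" by simp_all
    with Cons.prems(4)[of x y] y show False by simp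
  qed
  have irrefl: "\<not> R x x" using Cons.prems(4)[of x x] by auto
  have "x \<notin> set xs" using Cons.prems(1) irrefl by auto
  moreover have "x \<notin> set zs" using Cons.prems(2) irrefl ys xy by auto
  ultimately have "set xs = set zs" using Cons.prems(3) ys xy by auto
  moreover have "\<not> R b a" if "a \<in> set xs" "b \<in> set xs" "R a b" for a b
    using Cons.prems(4)[of a b] that by simp
  ultimately have "xs = zs"
    using Cons.prems(1,2) ys by (intro Cons.IH) simp_all
  with ys xy show ?case by simp
qed

lemma colex_enum_exists: "\<exists>xs. sorted_wrt colex_less xs \<and> set xs = Pow {1..m}"
proof (induction m)
  case 0
  have "sorted_wrt colex_less [{}] \<and> set [{}] = Pow {1..0::nat}" by auto
  then show ?case by blast
next
  case (Suc m)
  then obtain xs where xs: "sorted_wrt colex_less xs" "set xs = Pow {1..m}" by blast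
  let ?f = "insert (Suc m)"
  have eq: "sym_diff (?f A) (?f B) = sym_diff A B" if "A \<subseteq> {1..m}" "B \<subseteq> {1..m}" for A B
    using that by auto
  have "colex_less (?f A) (?f B)"
    if "A \<subseteq> {1..m}" "B \<subseteq> {1..m}" "colex_less A B" for A B
  proof -
    have "?f A \<noteq> ?f B" using eq[OF that(1,2)] that(3) by (auto simp: colex_less_def)
    then show ?thesis using that(3) unfolding colex_less_def eq[OF that(1,2)] by simp
  qed
  then have "sorted_wrt colex_less (map ?f xs)"
    using xs by (auto simp: sorted_wrt_map intro!: sorted_wrt_mono_rel[of xs colex_less])
  moreover have "colex_less A (?f B)" if "A \<subseteq> {1..m}" "B \<subseteq> {1..m}" for A B
  proof -
    have "Suc m \<notin> A" using that by auto
    moreover have "finite A" "finite B" using that finite_subset by blast+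
    ultimately have "Max (sym_diff A (?f B)) = Suc m"
      using that by (intro Max_eqI) (auto dest!: subsetD)
    then show ?thesis using \<open>Suc m \<notin> A\<close> by (auto simp: colex_less_def)
  qed
  ultimately have "sorted_wrt colex_less (xs @ map ?f xs)"
    using xs by (auto simp: sorted_wrt_append)
  moreover have "set (xs @ map ?f xs) = Pow {1..Suc m}"
    using xs by (simp add: Pow_insert atLeastAtMostSuc_conv)
  ultimately show ?case by blast
qed

lemma colex_enum:
  shows sorted_colex_enum: "sorted_wrt colex_less (colex_enum m)"
    and set_colex_enum: "set (colex_enum m) = Pow {1..m}"
proof -
  have "\<exists>!xs. sorted_wrt colex_less xs \<and> set xs = Pow {1..m}"
  proof (rule ex_ex1I[OF colex_enum_exists])
    fix xs ys
    assume *: "sorted_wrt colex_less xs \<and> set xs = Pow {1..m}"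
      "sorted_wrt colex_less ys \<and> set ys = Pow {1..m}"
    show "xs = ys"
    proof (rule sorted_wrt_asym_unique)
      fix A B assume "A \<in> set xs" "B \<in> set xs" "colex_less A B"
      moreover from this * have "finite A" "finite B"
        by (metis PowD finite_atLeastAtMost finite_subset)+
      ultimately show "\<not> colex_less B A" by (blast dest: colex_less_asym)
    qed (use * in auto)
  qed
  from theI'[OF this] show "sorted_wrt colex_less (colex_enum m)"
    "set (colex_enum m) = Pow {1..m}"
    unfolding colex_enum_def by blast+
qed

definition greedy_add :: "'p rel \<Rightarrow> nat set \<Rightarrow> nat set set \<Rightarrow> nat set set" where
  "greedy_add r X \<F> = (if has_induced_copy r (insert X \<F>) then \<F> else insert X \<F>)"

definition greedy_colex :: "nat \<Rightarrow> 'p rel \<Rightarrow> nat set set" where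
  "greedy_colex n r =
     fold (\<lambda>F \<F>. greedy_add r ({1..n} - F) (greedy_add r F \<F>)) (colex_enum (n - 1)) {}"

text \<open>The value at \<open>0\<close> is irrelevant.\<close>

definition T_family :: "nat \<Rightarrow> nat set set" where
  "T_family j =
     (if j = 0 then {}
      else if j = 1 then {{}}
      else if j = 2 then {{1}, {2}, {1, 2}}
      else if j = 3 then {{3}, {1, 3}, {2, 3}}
      else if even j then
        (let E = {i. even i \<and> 4 \<le> i \<and> i \<le> j} in {{1} \<union> E, {2} \<union> E, {1, 2} \<union> E})
      else
        (let D = {i. odd i \<and> 3 \<le> i \<and> i \<le> j} in {D, {1} \<union> D, {2} \<union> D}))"

definition T_co_family :: "nat \<Rightarrow> nat \<Rightarrow> nat set set" where
  "T_co_family j n = (\<lambda>T. {1..n} - T) ` T_family j"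

definition H_family :: "nat \<Rightarrow> nat set set" where
  "H_family n = (\<Union>j\<in>{1..n - 1}. T_family j \<union> T_co_family j n)"

end

theory Submission
  imports Defs
begin

text \<open>
  Call the sets in the families \<open>T_j\<close> low. Two incomparable low sets together cover one of the pairs
  \<open>{1, 2}\<close>, \<open>{1, 3}\<close>, \<open>{2, 3}\<close>; the low sets containing a given pair form a chain, and each of them is
  disjoint from every low set that avoids the pair. As two of these pairs always meet, neither low
  sets nor their complements can complete two incomparable low sets to a butterfly, and up to
  complementation every butterfly in \<open>H_n\<close> would have two low lower elements.

  Conversely, every \<open>F \<subseteq> [n - 1]\<close> that is not low completes a butterfly with colex smaller low sets
  and their complements; complementing it blocks \<open>[n] - F\<close> too. So \<open>H_n\<close> is butterfly-free and every
  set outside it is blocked by earlier members of it, which forces it to be the greedy output.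
\<close>

section \<open>Butterflies in set families, and their duality under complementation\<close>

text \<open>The non-relations between upper and lower elements follow from the two
  incomparabilities: \<open>c \<subseteq> a\<close>, for instance, would give
  \<open>b \<subseteq> c \<subseteq> a\<close>. Injectivity of the embedding then follows from
  antisymmetry of the order.\<close>

lemma has_induced_copy_butterfly_iff:
  "has_induced_copy butterfly \<F> \<longleftrightarrow>
     (\<exists>a\<in>\<F>. \<exists>b\<in>\<F>. \<exists>c\<in>\<F>. \<exists>d\<in>\<F>.
        \<not> a \<subseteq> b \<and> \<not> b \<subseteq> a \<and> \<not> c \<subseteq> d \<and> \<not> d \<subseteq> c \<and> a \<union> b \<subseteq> c \<inter> d)"
  (is "_ \<longleftrightarrow> ?R")
proof
  assume "has_induced_copy butterfly \<F>"
  then obtain G i where "G \<subseteq> \<F>" and bij: "bij_betw i (UNIV :: butterfly_elem set) G"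
    and i: "\<And>p q. (p, q) \<in> butterfly \<longleftrightarrow> i p \<subseteq> i q"
    unfolding has_induced_copy_def induced_copy_def Field_butterfly by auto
  then have "i p \<in> \<F>" for p by (auto simp: bij_betw_def)
  moreover have "\<not> i Elem_a \<subseteq> i Elem_b" "\<not> i Elem_b \<subseteq> i Elem_a"
    "\<not> i Elem_c \<subseteq> i Elem_d" "\<not> i Elem_d \<subseteq> i Elem_c"
    "i Elem_a \<union> i Elem_b \<subseteq> i Elem_c \<inter> i Elem_d"
    unfolding Un_subset_iff le_inf_iff i[symmetric] by (auto simp: butterfly_def)
  ultimately show ?R by blast
next
  assume ?R
  then obtain a b c d where abcd: "a \<in> \<F>" "b \<in> \<F>" "c \<in> \<F>" "d \<in> \<F>"
    "\<not> a \<subseteq> b" "\<not> b \<subseteq> a" "\<not> c \<subseteq> d" "\<not> d \<subseteq> c" "a \<union> b \<subseteq> c \<inter> d" by blast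
  let ?i = "case_butterfly_elem a b c d"
  have i: "(p, q) \<in> butterfly \<longleftrightarrow> ?i p \<subseteq> ?i q" for p q
    using abcd(5-) by (cases p; cases q) (auto simp: butterfly_def)
  have "inj ?i"
  proof (rule injI)
    fix p q assume "?i p = ?i q"
    then have "(p, q) \<in> butterfly" "(q, p) \<in> butterfly" by (simp_all add: i)
    then show "p = q" by (auto simp: butterfly_def)
  qed
  moreover have "range ?i \<subseteq> \<F>" using abcd by (auto split: butterfly_elem.split)
  ultimately show "has_induced_copy butterfly \<F>"
    unfolding has_induced_copy_def induced_copy_def Field_butterfly
    using i by (metis inj_on_imp_bij_betw)
qed

lemma has_induced_copy_butterflyI:
  assumes "a \<in> \<F>" "b \<in> \<F>" "c \<in> \<F>" "d \<in> \<F>"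
    "\<not> a \<subseteq> b" "\<not> b \<subseteq> a" "\<not> c \<subseteq> d" "\<not> d \<subseteq> c" "a \<union> b \<subseteq> c \<inter> d"
  shows "has_induced_copy butterfly \<F>"
  unfolding has_induced_copy_butterfly_iff
  by (intro bexI[of _ a] bexI[of _ b] bexI[of _ c] bexI[of _ d] conjI assms)

lemma has_induced_copy_mono:
  "has_induced_copy r \<F> \<Longrightarrow> \<F> \<subseteq> \<G> \<Longrightarrow> has_induced_copy r \<G>"
  unfolding has_induced_copy_def by blast

text \<open>The butterfly is self-dual: complementation in \<open>U\<close> reverses inclusion and
  exchanges the lower pair with the upper pair.\<close>

lemma has_induced_copy_butterfly_complement:
  assumes "has_induced_copy butterfly \<F>" "\<F> \<subseteq> Pow U"
  shows "has_induced_copy butterfly ((-) U ` \<F>)"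
proof -
  from assms(1) obtain a b c d where abcd: "a \<in> \<F>" "b \<in> \<F>" "c \<in> \<F>" "d \<in> \<F>"
    "\<not> a \<subseteq> b" "\<not> b \<subseteq> a" "\<not> c \<subseteq> d" "\<not> d \<subseteq> c" "a \<union> b \<subseteq> c \<inter> d"
    unfolding has_induced_copy_butterfly_iff by blast
  then have "a \<subseteq> U" "b \<subseteq> U" "c \<subseteq> U" "d \<subseteq> U" using assms(2) by auto
  then have "\<not> U - c \<subseteq> U - d" "\<not> U - d \<subseteq> U - c" "\<not> U - a \<subseteq> U - b" "\<not> U - b \<subseteq> U - a"
    "(U - c) \<union> (U - d) \<subseteq> (U - a) \<inter> (U - b)"
    using abcd(5-) by blast+
  then show ?thesis using abcd(1-4) by (intro has_induced_copy_butterflyI) auto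
qed

section \<open>Colex order and a certificate for the greedy output\<close>

text \<open>The element \<open>k\<close> bounds the maximum of the symmetric difference from below,
  and above \<open>k\<close> nothing of \<open>A\<close> lies outside \<open>B\<close>, so this
  maximum belongs to \<open>B\<close>.\<close>

lemma colex_lessI:
  assumes "finite A" "finite B" "k \<in> B" "k \<notin> A" "\<And>i. i \<in> A \<Longrightarrow> k < i \<Longrightarrow> i \<in> B"
  shows "colex_less A B"
proof -
  let ?M = "Max (sym_diff A B)"
  have "?M \<in> sym_diff A B" using assms by (intro Max_in) auto
  moreover have "k \<le> ?M" using assms by (intro Max_ge) auto
  ultimately have "?M \<in> B" using assms(3-) by (metis DiffD1 DiffD2 UnE le_neq_implies_less)
  then show ?thesis using assms(3,4) by (auto simp: colex_less_def)
qed

lemma colex_enum_prefix: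
  assumes "colex_enum m = us @ B # vs" "A \<subseteq> {1..m}" "colex_less A B"
  shows "A \<in> set us"
proof (rule ccontr)
  assume "A \<notin> set us"
  moreover have "A \<in> set (us @ B # vs)" "B \<in> set (us @ B # vs)"
    using assms(2) unfolding assms(1)[symmetric] set_colex_enum
    using set_colex_enum[of m] assms(1) by auto
  moreover have "A \<noteq> B" using assms(3) by (auto simp: colex_less_def)
  ultimately have "A \<in> set vs" by auto
  then have "colex_less B A"
    using sorted_colex_enum[of m] unfolding assms(1) by (auto simp: sorted_wrt_append)
  moreover have "B \<subseteq> {1..m}" using set_colex_enum[of m] assms(1) by auto
  ultimately show False
    using colex_less_asym[OF assms(3)] assms(2) finite_subset[OF _ finite_atLeastAtMost] by blast
qed

text \<open>While the current family stays inside \<open>\<H>\<close>, every member of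
  \<open>\<H>\<close> is accepted because \<open>\<H>\<close> is free, and every other set is
  rejected because a copy with it arises from members of \<open>\<H>\<close> added in strictly
  earlier rounds.\<close>

lemma greedy_colex_eqI:
  assumes free: "\<not> has_induced_copy r \<H>"
    and H: "\<H> \<subseteq> Pow {1..n}"
    and low: "\<And>F. F \<subseteq> {1..n - 1} \<Longrightarrow> F \<notin> \<H> \<Longrightarrow> has_induced_copy r (insert F
      {X \<in> \<H>. \<exists>Y. Y \<subseteq> {1..n - 1} \<and> colex_less Y F \<and> (X = Y \<or> X = {1..n} - Y)})"
    and high: "\<And>F. F \<subseteq> {1..n - 1} \<Longrightarrow> {1..n} - F \<notin> \<H> \<Longrightarrow> has_induced_copy r (insert ({1..n} - F)
      {X \<in> \<H>. \<exists>Y. Y \<subseteq> {1..n - 1} \<and> colex_less Y F \<and> (X = Y \<or> X = {1..n} - Y)})"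
  shows "greedy_colex n r = \<H>"
proof -
  let ?f = "\<lambda>F \<F>. greedy_add r ({1..n} - F) (greedy_add r F \<F>)"
  let ?S = "\<lambda>us. {X \<in> \<H>. \<exists>Y\<in>set us. X = Y \<or> X = {1..n} - Y}"
  have add: "greedy_add r X \<F> = (if X \<in> \<H> then insert X \<F> else \<F>)"
    if "\<F> \<subseteq> \<H>" "X \<notin> \<H> \<Longrightarrow> has_induced_copy r (insert X \<F>)" for X \<F>
    using that free has_induced_copy_mono[of r "insert X \<F>" \<H>] by (auto simp: greedy_add_def)
  \<comment> \<open>Invariant: after the rounds in \<open>us\<close> the family consists of exactly
    those members of \<open>\<H>\<close> that were considered so far.\<close>
  have "fold ?f us {} = ?S us" if "colex_enum (n - 1) = us @ vs" for us vs
    using that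
  proof (induction us arbitrary: vs rule: rev_induct)
    case Nil
    then show ?case by simp
  next
    case (snoc F us)
    then have IH: "fold ?f us {} = ?S us" by simp
    have split: "colex_enum (n - 1) = us @ F # vs" using snoc.prems by simp
    then have F: "F \<subseteq> {1..n - 1}" using set_colex_enum[of "n - 1"] by auto
    let ?E = "{X \<in> \<H>. \<exists>Y. Y \<subseteq> {1..n - 1} \<and> colex_less Y F \<and> (X = Y \<or> X = {1..n} - Y)}"
    have sub: "?E \<subseteq> ?S us" using colex_enum_prefix[OF split] by blast
    have 1: "greedy_add r F (?S us) = (if F \<in> \<H> then insert F (?S us) else ?S us)" (is "_ = ?S'")
    proof (rule add)
      show "?S us \<subseteq> \<H>" by (rule Collect_restrict)
      show "has_induced_copy r (insert F (?S us))" if "F \<notin> \<H>"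
        by (rule has_induced_copy_mono[OF low[OF F that] insert_mono[OF sub]])
    qed
    have 2: "greedy_add r ({1..n} - F) ?S' =
        (if {1..n} - F \<in> \<H> then insert ({1..n} - F) ?S' else ?S')"
    proof (rule add)
      show "?S' \<subseteq> \<H>" by auto
      have "?S us \<subseteq> ?S'" by (simp add: subset_insertI)
      with sub have "?E \<subseteq> ?S'" by (rule subset_trans)
      then show "has_induced_copy r (insert ({1..n} - F) ?S')" if "{1..n} - F \<notin> \<H>"
        by (rule has_induced_copy_mono[OF high[OF F that] insert_mono])
    qed
    have "fold ?f (us @ [F]) {} = (if {1..n} - F \<in> \<H> then insert ({1..n} - F) ?S' else ?S')"
      by (simp only: fold_append o_apply fold_simps id_apply IH 1 2)
    also have "\<dots> = ?S (us @ [F])" by auto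
    finally show ?case .
  qed
  from this[of "colex_enum (n - 1)" "[]"]
  have "greedy_colex n r = ?S (colex_enum (n - 1))" by (simp add: greedy_colex_def)
  also have "\<dots> = \<H>"
  proof -
    \<comment> \<open>Every subset of \<open>{1..n}\<close> is considered in some round: directly if
      it lacks \<open>n\<close>, as a complement otherwise.\<close>
    have "\<exists>Y\<in>Pow {1..n - 1}. X = Y \<or> X = {1..n} - Y" if "X \<subseteq> {1..n}" for X
    proof (cases "n \<in> X")
      case True
      then have "{1..n} - X \<in> Pow {1..n - 1}" using that by (auto simp: le_less)
      moreover have "X = {1..n} - ({1..n} - X)" using that by auto
      ultimately show ?thesis by blast
    next
      case False
      then have "X \<in> Pow {1..n - 1}" using that
        by (smt (verit) PowI atLeastAtMost_iff diff_diff_cancel diff_is_0_eq' diff_le_mono2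
            le_antisym not_less_eq_eq subset_iff One_nat_def Suc_pred le_zero_eq not_gr_zero)
      then show ?thesis by blast
    qed
    then show ?thesis using H unfolding set_colex_enum by blast
  qed
  finally show ?thesis .
qed

section \<open>Low sets and the size of \<open>H_n\<close>\<close>

definition evens :: "nat \<Rightarrow> nat set" where
  "evens m = {i. even i \<and> 4 \<le> i \<and> i \<le> m}"

definition odds :: "nat \<Rightarrow> nat set" where
  "odds m = {i. odd i \<and> 3 \<le> i \<and> i \<le> m}"

text \<open>An index \<open>m\<close> of the wrong parity, or \<open>m < 4\<close> for \<^const>\<open>evens\<close>, only repeats a smaller level.\<close>

definition low_set :: "nat set \<Rightarrow> bool" where
  "low_set X \<longleftrightarrow> X = {} \<or>
     (\<exists>m. X = {1} \<union> evens m \<or> X = {2} \<union> evens m \<or> X = {1, 2} \<union> evens m) \<or>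
     (\<exists>m\<ge>3. X = odds m \<or> X = {1} \<union> odds m \<or> X = {2} \<union> odds m)"

lemma evens_mem [simp]: "i \<in> evens m \<longleftrightarrow> even i \<and> 4 \<le> i \<and> i \<le> m"
  by (simp add: evens_def)

lemma odds_mem [simp]: "i \<in> odds m \<longleftrightarrow> odd i \<and> 3 \<le> i \<and> i \<le> m"
  by (simp add: odds_def)

lemma evens_chain: "evens m \<subseteq> evens k \<or> evens k \<subseteq> evens m"
  by (auto simp: subset_iff)

lemma odds_chain: "odds m \<subseteq> odds k \<or> odds k \<subseteq> odds m"
  by (auto simp: subset_iff)

lemma low_set_evens:
  "low_set ({1} \<union> evens m)" "low_set ({2} \<union> evens m)" "low_set ({1, 2} \<union> evens m)"
  by (auto simp: low_set_def)

lemma low_set_odds: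
  assumes "m \<ge> 3"
  shows "low_set (odds m)" "low_set ({1} \<union> odds m)" "low_set ({2} \<union> odds m)"
  using assms by (auto simp: low_set_def)

lemma low_set_small:
  "low_set {}" "low_set {1}" "low_set {2}" "low_set {1, 2}" "low_set {3}"
proof -
  have "evens 0 = {}" "odds 3 = {3}" by (auto simp: evens_def odds_def)
  then show "low_set {}" "low_set {1}" "low_set {2}" "low_set {1, 2}" "low_set {3}"
    using low_set_evens[of 0] low_set_odds[of 3] by (auto simp: low_set_def)
qed

text \<open>From level 3 on, \<open>j\<close> is the maximum of each set in
  \<open>T_family j\<close>, so bounding the level by \<open>n - 1\<close> amounts to bounding the
  elements. Levels 1 and 2 are both available because \<open>n \<ge> 3\<close>.\<close>

lemma low_set_iff_T_family:
  assumes "n \<ge> 3"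
  shows "(\<exists>j\<in>{1..n - 1}. X \<in> T_family j) \<longleftrightarrow> low_set X \<and> X \<subseteq> {1..n - 1}"
proof
  assume "\<exists>j\<in>{1..n - 1}. X \<in> T_family j"
  then obtain j where j: "1 \<le> j" "j \<le> n - 1" "X \<in> T_family j" by auto
  have o3: "odds 3 = {3}" by (auto simp: odds_def)
  consider "j = 1" | "j = 2" | "j = 3" | "j \<ge> 4" using j by linarith
  then show "low_set X \<and> X \<subseteq> {1..n - 1}"
  proof cases
    case 1
    then show ?thesis using j low_set_small by (auto simp: T_family_def)
  next
    case 2
    then show ?thesis using j low_set_small by (auto simp: T_family_def)
  next
    case 3
    then show ?thesis using j low_set_odds[of 3] unfolding o3 by (auto simp: T_family_def insert_commute)
  next
    case 4
    then show ?thesis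
      using j low_set_evens[of j] low_set_odds[of j]
      by (auto simp: T_family_def Let_def evens_def odds_def split: if_splits)
  qed
next
  assume X: "low_set X \<and> X \<subseteq> {1..n - 1}"
  have e: "\<exists>j\<in>{1..n - 1}. X \<in> T_family j"
    if "X = x \<union> evens m" "x \<in> {{1}, {2}, {1, 2}}" for x m
  proof (cases "m < 4")
    case True
    then have "evens m = {}" by (auto simp: evens_def)
    then have "X \<in> T_family 2" using that by (auto simp: T_family_def)
    then show ?thesis using assms by (intro bexI[of _ 2]) auto
  next
    case False
    \<comment> \<open>Rounding \<open>m\<close> down to an even number keeps the tail and makes
      \<open>j\<close> an element of \<open>X\<close>, whence \<open>j \<le> n - 1\<close>.\<close>
    define j where "j = (if even m then m else m - 1)"
    have j: "even j" "4 \<le> j" "j \<le> m" "m \<le> Suc j" using False by (auto simp: j_def) presburger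
    then have "evens m = evens j" by (auto simp: evens_def le_Suc_eq)
    moreover have "j \<in> X" using that j by auto
    moreover have "X \<in> T_family j"
      using that j calculation(1) by (auto simp: T_family_def Let_def evens_def)
    ultimately show ?thesis using X by auto
  qed
  have o: "\<exists>j\<in>{1..n - 1}. X \<in> T_family j"
    if "X = x \<union> odds m" "x \<in> {{}, {1}, {2}}" "m \<ge> 3" for x m
  proof -
    define j where "j = (if odd m then m else m - 1)"
    have j: "odd j" "3 \<le> j" "j \<le> m" "m \<le> Suc j" using that(3) unfolding j_def by presburger+
    then have eq: "odds m = odds j" by (auto simp: odds_def le_Suc_eq)
    have "j \<in> X" using that j by auto
    moreover have "X \<in> T_family j"
    proof (cases "j = 3")
      case True
      moreover have "odds 3 = {3}" by (auto simp: odds_def)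
      ultimately show ?thesis using that eq by (auto simp: T_family_def)
    next
      case False
      then show ?thesis using that j eq by (auto simp: T_family_def Let_def odds_def)
    qed
    ultimately show ?thesis using X by auto
  qed
  have z: "\<exists>j\<in>{1..n - 1}. X \<in> T_family j" if "X = {}"
    using assms that by (intro bexI[of _ 1]) (auto simp: T_family_def)
  show "\<exists>j\<in>{1..n - 1}. X \<in> T_family j"
    using X z e[of "{1}"] e[of "{2}"] e[of "{1, 2}"] o[of "{}"] o[of "{1}"] o[of "{2}"]
    unfolding low_set_def by auto
qed

lemma H_family_eq:
  assumes "n \<ge> 3"
  shows "H_family n = {X. low_set X \<and> X \<subseteq> {1..n - 1}} \<union>
    (-) {1..n} ` {X. low_set X \<and> X \<subseteq> {1..n - 1}}"
proof -
  have "H_family n = (\<Union>j\<in>{1..n - 1}. T_family j) \<union> (-) {1..n} ` (\<Union>j\<in>{1..n - 1}. T_family j)"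
    by (auto simp: H_family_def T_co_family_def)
  moreover have "(\<Union>j\<in>{1..n - 1}. T_family j) = {X. low_set X \<and> X \<subseteq> {1..n - 1}}"
    using low_set_iff_T_family[OF assms] by auto
  ultimately show ?thesis by simp
qed

text \<open>One set at level 1 and at most three at each of the \<open>n - 2\<close> further levels
  make at most \<open>3 * n - 5\<close>; adding the complements at most doubles this.\<close>

lemma card_H_family:
  assumes "n \<ge> 3"
  shows "card (H_family n) \<le> 6 * n - 10"
proof -
  have fin: "finite (T_family j)" for j by (auto simp: T_family_def Let_def)
  have c3: "card (T_family j) \<le> 3" for j
    by (auto simp: T_family_def Let_def card_insert_if)
  let ?T = "\<Union>j\<in>{1..n - 1}. T_family j"
  have "card ?T \<le> card (T_family 1) + card (\<Union>j\<in>{2..n - 1}. T_family j)"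
  proof -
    have "{1..n - 1} = insert 1 {2..n - 1}" using assms by auto
    then show ?thesis by (simp add: card_Un_le)
  qed
  also have "card (\<Union>j\<in>{2..n - 1}. T_family j) \<le> (\<Sum>j\<in>{2..n - 1}. card (T_family j))"
    by (rule card_UN_le) simp
  also have "\<dots> \<le> (\<Sum>j\<in>{2..n - 1}. 3)" by (intro sum_mono c3)
  also have "card (T_family 1) = 1" by (simp add: T_family_def)
  finally have T: "card ?T \<le> 3 * n - 5" using assms by simp
  have "H_family n = ?T \<union> (-) {1..n} ` ?T"
    by (auto simp: H_family_def T_co_family_def)
  then have "card (H_family n) \<le> card ?T + card ((-) {1..n} ` ?T)" by (simp add: card_Un_le)
  also have "\<dots> \<le> card ?T + card ?T" using fin by (intro add_left_mono card_image_le) auto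
  finally show ?thesis using T by linarith
qed

section \<open>Butterfly-freeness of \<open>H_n\<close>\<close>

text \<open>A nonempty low set is a head inside \<open>{1, 2}\<close> with an even or odd tail.
  Equal heads and parities would make the sets comparable. Distinct heads of even type cover
  \<open>{1, 2}\<close>; distinct heads of odd type supply 1 or 2 next to the common 3; for mixed
  types the even one supplies 1 or 2 and the odd one 3.\<close>

lemma low_set_incomparable:
  assumes "low_set a" "low_set b" "\<not> a \<subseteq> b" "\<not> b \<subseteq> a"
  shows "\<exists>P\<in>{{1, 2}, {1, 3}, {2, 3}}. P \<subseteq> a \<union> b"
proof -
  let ?even = "\<lambda>c x k. x \<in> {{1}, {2}, {1, 2}} \<and> c = x \<union> evens k"
  let ?odd = "\<lambda>c x k. x \<in> {{}, {1}, {2}} \<and> 3 \<in> c \<and> c = x \<union> odds k"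
  have shape: "\<exists>k. (\<exists>x\<in>{{1}, {2}, {1, 2}}. c = x \<union> evens k) \<or>
      3 \<in> c \<and> (\<exists>x\<in>{{}, {1}, {2}}. c = x \<union> odds k)" if "low_set c" "c \<noteq> {}" for c
    using that by (auto simp: low_set_def)
  have "a \<noteq> {}" "b \<noteq> {}" using assms by auto
  obtain x k where a: "?even a x k \<or> ?odd a x k" using shape[OF assms(1) \<open>a \<noteq> {}\<close>] by blast
  obtain y m where b: "?even b y m \<or> ?odd b y m" using shape[OF assms(2) \<open>b \<noteq> {}\<close>] by blast
  consider "?even a x k" "?even b y m" | "?odd a x k" "?odd b y m"
    | "?even a x k" "3 \<in> b" | "3 \<in> a" "?even b y m"
    using a b by argo
  then show ?thesis
  proof cases
    case 1
    then have "x \<noteq> y" using assms(3,4) evens_chain[of k m] by blast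
    then have "{1, 2} \<subseteq> x \<union> y" using 1 by auto
    then show ?thesis using 1 by auto
  next
    case 2
    then have "x \<noteq> y" using assms(3,4) odds_chain[of k m] by blast
    then have "1 \<in> x \<union> y \<or> 2 \<in> x \<union> y" using 2 by auto
    then show ?thesis using 2 by auto
  qed auto
qed

text \<open>A pair fixes both the head and the parity of the tail, so that only the length of the
  tail stays free.\<close>

lemma low_set_pair:
  assumes "low_set c"
  shows "{1, 2} \<subseteq> c \<Longrightarrow> \<exists>m. c = {1, 2} \<union> evens m"
    and "{1, 3} \<subseteq> c \<Longrightarrow> \<exists>m. c = {1} \<union> odds m"
    and "{2, 3} \<subseteq> c \<Longrightarrow> \<exists>m. c = {2} \<union> odds m"
  using assms by (auto simp: low_set_def)

lemma low_set_chain: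
  assumes "low_set c" "low_set d" "P \<in> {{1, 2}, {1, 3}, {2, 3}}" "P \<subseteq> c" "P \<subseteq> d"
  shows "c \<subseteq> d \<or> d \<subseteq> c"
proof -
  obtain x k m where "c = x \<union> evens k \<and> d = x \<union> evens m \<or> c = x \<union> odds k \<and> d = x \<union> odds m"
    using assms low_set_pair[of c] low_set_pair[of d] by (smt (verit) insertE singletonD)
  then show ?thesis using evens_chain[of k m] odds_chain[of k m] by blast
qed

text \<open>Avoiding the pair forces the opposite parity on a nonempty \<open>y\<close>: without 1
  and 2 it must be some \<open>odds m\<close>; without 3 and one of 1, 2 it is the other one
  followed by an even tail.\<close>

lemma low_set_disjoint:
  assumes "low_set c" "low_set y" "P \<in> {{1, 2}, {1, 3}, {2, 3}}" "P \<subseteq> c" "P \<inter> y = {}"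
  shows "c \<inter> y = {}"
proof -
  consider m where "P = {1, 2}" "c = {1, 2} \<union> evens m" | m where "P = {1, 3}" "c = {1} \<union> odds m"
    | m where "P = {2, 3}" "c = {2} \<union> odds m"
    using assms low_set_pair[of c] by blast
  then show ?thesis
    by cases (use assms(2,5) in \<open>auto simp: low_set_def disjoint_iff\<close>)
qed

lemma H_family_free:
  assumes "n \<ge> 3"
  shows "\<not> has_induced_copy butterfly (H_family n)"
proof
  let ?L = "{X. low_set X \<and> X \<subseteq> {1..n - 1}}"
  let ?c = "(-) {1..n}"
  have H: "X \<in> ?L \<or> (\<exists>Y\<in>?L. X = ?c Y)" if "X \<in> H_family n" for X
    using that unfolding H_family_eq[OF assms] by blast
  have n: "n \<in> ?c Y" "n \<notin> Y" "?c (?c Y) = Y" if "Y \<in> ?L" for Y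
    using that assms by force+
  \<comment> \<open>Upper pair \<open>c\<close> and the complement of \<open>y\<close>: that
    \<open>c\<close> is not contained in this complement means
    \<open>c \<inter> y \<noteq> {}\<close>.\<close>
  have low_up: False
    if *: "low_set a" "low_set b" "\<not> a \<subseteq> b" "\<not> b \<subseteq> a" "low_set c" "low_set y"
      "a \<union> b \<subseteq> c" "(a \<union> b) \<inter> y = {}" "c \<inter> y \<noteq> {}" for a b c y
  proof -
    obtain P where "P \<in> {{1, 2}, {1, 3}, {2, 3}}" "P \<subseteq> a \<union> b"
      using low_set_incomparable[OF *(1-4)] by blast
    then show False using low_set_disjoint[OF *(5,6), of P] *(7-) by blast
  qed
  have low_low: False
    if *: "low_set a" "low_set b" "\<not> a \<subseteq> b" "\<not> b \<subseteq> a" "low_set c" "low_set d"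
      "\<not> c \<subseteq> d" "\<not> d \<subseteq> c" "a \<union> b \<subseteq> c \<inter> d" for a b c d
  proof -
    obtain P where "P \<in> {{1, 2}, {1, 3}, {2, 3}}" "P \<subseteq> a \<union> b"
      using low_set_incomparable[OF *(1-4)] by blast
    then show False using low_set_chain[OF *(5,6), of P] *(7-) by blast
  qed
  \<comment> \<open>Both upper elements are complements, of \<open>c\<close> and \<open>d\<close>.
    The pairs covered by \<open>a \<union> b\<close> and by \<open>c \<union> d\<close> meet,
    although these unions are disjoint.\<close>
  have low_high: False
    if *: "low_set a" "low_set b" "\<not> a \<subseteq> b" "\<not> b \<subseteq> a" "low_set c" "low_set d"
      "\<not> c \<subseteq> d" "\<not> d \<subseteq> c" "(a \<union> b) \<inter> (c \<union> d) = {}" for a b c d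
  proof -
    obtain P Q where "P \<in> {{1, 2}, {1, 3}, {2, 3}}" "P \<subseteq> a \<union> b"
      "Q \<in> {{1, 2}, {1, 3}, {2, 3}}" "Q \<subseteq> c \<union> d"
      using low_set_incomparable[OF *(1-4)] low_set_incomparable[OF *(5-8)] by blast
    moreover from this have "P \<inter> Q \<noteq> {}" by auto
    ultimately show False using *(9) by blast
  qed
  assume "has_induced_copy butterfly (H_family n)"
  then obtain a b c d where abcd: "a \<in> H_family n" "b \<in> H_family n" "c \<in> H_family n" "d \<in> H_family n"
    "\<not> a \<subseteq> b" "\<not> b \<subseteq> a" "\<not> c \<subseteq> d" "\<not> d \<subseteq> c" "a \<union> b \<subseteq> c \<inter> d"
    unfolding has_induced_copy_butterfly_iff by blast
  have main: False
    if *: "a \<in> ?L" "b \<in> ?L" "c \<in> H_family n" "d \<in> H_family n"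
      "\<not> a \<subseteq> b" "\<not> b \<subseteq> a" "\<not> c \<subseteq> d" "\<not> d \<subseteq> c" "a \<union> b \<subseteq> c \<inter> d" for a b c d
  proof -
    consider "c \<in> ?L" "d \<in> ?L" | y where "c \<in> ?L" "y \<in> ?L" "d = ?c y"
      | y where "d \<in> ?L" "y \<in> ?L" "c = ?c y"
      | y z where "y \<in> ?L" "z \<in> ?L" "c = ?c y" "d = ?c z"
      using H *(3,4) by meson
    then show False
    proof cases
      case 1
      then show False using low_low[of a b c d] * by blast
    next
      case 2
      have "c \<subseteq> {1..n}" using 2 by force
      then show False using low_up[of a b c y] * 2 by blast
    next
      case 3
      have "d \<subseteq> {1..n}" using 3 by force
      then show False using low_up[of a b d y] * 3 by blast
    next
      case 4
      then show False using low_high[of a b y z] * by blast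
    qed
  qed
  show False
  proof (cases "a \<in> ?L \<and> b \<in> ?L")
    case True
    then show False using main abcd by blast
  next
    case False
    have sub: "X \<subseteq> {1..n}" "?c (?c X) = X" "?c X \<in> H_family n" if "X \<in> H_family n" for X
    proof -
      show X: "X \<subseteq> {1..n}" using H[OF that] by force
      then show *: "?c (?c X) = X" by blast
      show "?c X \<in> H_family n" using that n(3) unfolding H_family_eq[OF assms] by force
    qed
    \<comment> \<open>A lower element that is not low contains \<open>n\<close>, hence so do both
      upper elements, which are therefore complements of low sets. Complementing the butterfly makes
      its lower pair low.\<close>
    have "n \<in> a \<or> n \<in> b" using False H[OF abcd(1)] H[OF abcd(2)] n by blast
    then have "n \<in> c" "n \<in> d" using abcd(9) by auto
    then have "?c c \<in> ?L" "?c d \<in> ?L" using H[OF abcd(3)] H[OF abcd(4)] n by auto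
    moreover have "\<not> ?c c \<subseteq> ?c d" "\<not> ?c d \<subseteq> ?c c" "\<not> ?c a \<subseteq> ?c b" "\<not> ?c b \<subseteq> ?c a"
      "?c c \<union> ?c d \<subseteq> ?c a \<inter> ?c b"
      using abcd(5-) sub(1)[OF abcd(1)] sub(1)[OF abcd(2)] sub(1)[OF abcd(3)] sub(1)[OF abcd(4)]
      by blast+
    ultimately show False using main[of "?c c" "?c d" "?c a" "?c b"] sub(3) abcd(1,2) by blast
  qed
qed

section \<open>Blocking the sets outside \<open>H_n\<close>\<close>

text \<open>The material for blocking \<open>F\<close>: for \<open>n \<ge> 3\<close>, these sets and
  their complements are the members of \<open>H_n\<close> considered in rounds before that of
  \<open>F\<close>.\<close>

definition earlier :: "nat \<Rightarrow> nat set \<Rightarrow> nat set set" where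
  "earlier n F = {Y. low_set Y \<and> Y \<subseteq> {1..n - 1} \<and> colex_less Y F}"

text \<open>The colex comparison is decided at \<open>k\<close>, or, if \<open>Y\<close> contains
  \<open>k\<close> as well, at \<open>k - 1\<close>.\<close>

lemma earlierI:
  assumes "low_set Y" "Y \<subseteq> {1..k}" "k \<in> F" "F \<subseteq> {1..n - 1}"
    and "k \<notin> Y \<or> k - 1 \<in> F \<and> k - 1 \<notin> Y"
  shows "Y \<in> earlier n F"
proof -
  have fin: "finite Y" "finite F" using assms(2,4) finite_subset by blast+
  have "colex_less Y F"
  proof (cases "k \<in> Y")
    case True
    show ?thesis
    proof (rule colex_lessI[OF fin])
      show "k - 1 \<in> F" "k - 1 \<notin> Y" using assms(5) True by auto
      show "i \<in> F" if "i \<in> Y" "k - 1 < i" for i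
      proof -
        have "i = k" using that assms(2) by force
        then show ?thesis using assms(3) by simp
      qed
    qed
  next
    case False
    show ?thesis by (rule colex_lessI[OF fin assms(3) False]) (use assms(2) in force)
  qed
  moreover have "Y \<subseteq> {1..n - 1}" using assms(2,3,4) by force
  ultimately show ?thesis using assms(1) by (simp add: earlier_def)
qed

text \<open>There are four blocking patterns: \<open>F\<close> is an upper or a lower element, and
  its partner in the same pair is a member of \<open>\<E>\<close> or a complement of one. Here
  \<open>F\<close> is upper with partner \<open>d\<close>.\<close>

lemma blocked_upper:
  assumes "a \<in> \<E>" "b \<in> \<E>" "\<not> a \<subseteq> b" "\<not> b \<subseteq> a" "d \<in> \<E>" "\<not> F \<subseteq> d" "\<not> d \<subseteq> F" "a \<union> b \<subseteq> F \<inter> d"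
  shows "has_induced_copy butterfly (insert F (\<E> \<union> (-) U ` \<E>))"
  by (rule has_induced_copy_butterflyI[of a _ b F d]) (use assms in auto)

text \<open>\<open>F\<close> is upper with partner \<open>U - y\<close>; the point \<open>u\<close>
  lies in the partner but not in \<open>F\<close>.\<close>

lemma blocked_upper_complement:
  assumes "a \<in> \<E>" "b \<in> \<E>" "\<not> a \<subseteq> b" "\<not> b \<subseteq> a" "y \<in> \<E>" "F \<inter> y \<noteq> {}" "u \<in> U" "u \<notin> F" "u \<notin> y"
    "a \<union> b \<subseteq> F" "(a \<union> b) \<inter> y = {}" "F \<subseteq> U"
  shows "has_induced_copy butterfly (insert F (\<E> \<union> (-) U ` \<E>))"
proof (rule has_induced_copy_butterflyI[OF _ _ _ _ assms(3,4)])
  show "\<not> F \<subseteq> U - y" using assms(6) by blast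
  show "\<not> U - y \<subseteq> F" using assms(7-9) by blast
  show "a \<union> b \<subseteq> F \<inter> (U - y)" using assms(10-12) by blast
qed (use assms(1,2,5) in auto)

text \<open>The upper elements of the copy are the complements of \<open>y\<close> and \<open>z\<close>.\<close>

lemma blocked_lower:
  assumes "y \<in> \<E>" "z \<in> \<E>" "\<not> y \<subseteq> z" "\<not> z \<subseteq> y" "b \<in> \<E>" "\<not> F \<subseteq> b" "\<not> b \<subseteq> F"
    "(F \<union> b) \<inter> (y \<union> z) = {}" "F \<subseteq> U" "b \<subseteq> U" "y \<subseteq> U" "z \<subseteq> U"
  shows "has_induced_copy butterfly (insert F (\<E> \<union> (-) U ` \<E>))"
proof (rule has_induced_copy_butterflyI[OF _ _ _ _ assms(6,7)])
  show "\<not> U - y \<subseteq> U - z" using assms(4,12) by blast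
  show "\<not> U - z \<subseteq> U - y" using assms(3,11) by blast
  show "F \<union> b \<subseteq> (U - y) \<inter> (U - z)" using assms(8-10) by blast
qed (use assms(1,2,5) in auto)

text \<open>\<open>F\<close> is lower with partner \<open>U - w\<close>, both below the complements
  of \<open>y\<close> and \<open>z\<close>; the point \<open>u\<close> lies in the partner but not
  in \<open>F\<close>.\<close>

lemma blocked_lower_complement:
  assumes "y \<in> \<E>" "z \<in> \<E>" "\<not> y \<subseteq> z" "\<not> z \<subseteq> y" "w \<in> \<E>" "F \<inter> w \<noteq> {}" "u \<in> U" "u \<notin> F" "u \<notin> w"
    "y \<union> z \<subseteq> w" "F \<inter> (y \<union> z) = {}" "F \<subseteq> U" "w \<subseteq> U"
  shows "has_induced_copy butterfly (insert F (\<E> \<union> (-) U ` \<E>))"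
proof (rule has_induced_copy_butterflyI)
  show "\<not> F \<subseteq> U - w" using assms(6) by blast
  show "\<not> U - w \<subseteq> F" using assms(7-9) by blast
  show "\<not> U - y \<subseteq> U - z" using assms(4,10,13) by blast
  show "\<not> U - z \<subseteq> U - y" using assms(3,10,13) by blast
  show "F \<union> (U - w) \<subseteq> (U - y) \<inter> (U - z)" using assms(10-12) by blast
qed (use assms(1,2,5) in auto)

lemma low_set_subset_12:
  assumes "F \<subseteq> {1, 2}"
  shows "low_set F"
proof -
  have "F \<in> Pow {1, 2}" using assms by simp
  then have "F = {} \<or> F = {1} \<or> F = {2} \<or> F = {1, 2}" by (auto simp: Pow_insert)
  then show ?thesis using low_set_small by metis
qed

text \<open>Except when \<open>F\<close> avoids \<open>{1, 2, 3}\<close>: either \<open>F\<close> misses an element below \<open>k = Max F\<close> of the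
  long chain of low sets determined by \<open>F \<inter> {1, 2, 3}\<close>, or it contains that chain and an element
  \<open>p\<close> of the other parity. If \<open>p = k\<close>, then \<open>k - 1 \<in> F\<close> is what makes the blocking set colex smaller.\<close>

lemma has_induced_copy_insert_earlier:
  assumes F: "F \<subseteq> {1..n - 1}" and "\<not> low_set F"
  shows "has_induced_copy butterfly (insert F (earlier n F \<union> (-) {1..n} ` earlier n F))"
proof -
  define k where "k = Max F"
  have fin: "finite F" using F finite_subset by blast
  have "F \<noteq> {}" using assms(2) low_set_small by auto
  then have kF: "k \<in> F" and Fk: "F \<subseteq> {1..k}"
    using fin F by (auto simp: k_def)
  have k3: "k \<ge> 3"
  proof (rule ccontr)
    assume "\<not> k \<ge> 3"
    then have "F \<subseteq> {1, 2}" using Fk by force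
    then show False using low_set_subset_12 assms(2) by blast
  qed
  have kn: "k \<le> n - 1" and n: "n \<in> {1..n}" "n \<notin> F" and Fn: "F \<subseteq> {1..n}"
    using F kF k3 by force+
  let ?E = "earlier n F"
  note early = earlierI[OF _ _ kF F]
  have En: "Y \<subseteq> {1..n}" "n \<notin> Y" if "Y \<in> ?E" for Y
    using that k3 kn by (force simp: earlier_def)+
  have e1: "{1} \<in> ?E" and e2: "{2} \<in> ?E" using k3 by (intro early low_set_small; simp)+
  \<comment> \<open>\<open>{3}\<close> avoids \<open>k\<close> only for \<open>k > 3\<close>, so
    each case that uses it first derives \<open>3 < k\<close>.\<close>
  have e3: "{3} \<in> ?E" if "k > 3" using that by (intro early low_set_small) simp_all
  \<comment> \<open>\<open>evens_eq\<close> and \<open>odds_eq\<close> are applied contrapositively: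
    a full chain without an element of the other parity would make \<open>F\<close> low, so such an
    element \<open>p\<close> exists.\<close>
  have evens_eq: "F = (F \<inter> {1, 2}) \<union> evens k"
    if "\<forall>j<k. even j \<longrightarrow> 4 \<le> j \<longrightarrow> j \<in> F" "\<forall>p\<in>F. odd p \<longrightarrow> \<not> 3 \<le> p"
  proof (intro set_eqI iffI)
    fix i assume i: "i \<in> F"
    then have "i \<le> k" "1 \<le> i" using Fk by auto
    show "i \<in> (F \<inter> {1, 2}) \<union> evens k"
    proof (cases "i \<le> 2")
      case True
      then have "i = 1 \<or> i = 2" using \<open>1 \<le> i\<close> by linarith
      then show ?thesis using i by auto
    next
      case False
      then have "even i" using that(2) i by auto
      then have "4 \<le> i" using False by presburger
      then show ?thesis using \<open>even i\<close> \<open>i \<le> k\<close> by simp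
    qed
  next
    fix i assume "i \<in> (F \<inter> {1, 2}) \<union> evens k"
    then show "i \<in> F" using that(1) kF by (cases "i = k") auto
  qed
  have odds_eq: "F = (F \<inter> {1, 2}) \<union> odds k"
    if "\<forall>j<k. odd j \<longrightarrow> 3 \<le> j \<longrightarrow> j \<in> F" "\<forall>p\<in>F. even p \<longrightarrow> \<not> 4 \<le> p"
  proof (intro set_eqI iffI)
    fix i assume i: "i \<in> F"
    then have "i \<le> k" "1 \<le> i" using Fk by auto
    show "i \<in> (F \<inter> {1, 2}) \<union> odds k"
    proof (cases "i \<le> 2")
      case True
      then have "i = 1 \<or> i = 2" using \<open>1 \<le> i\<close> by linarith
      then show ?thesis using i by auto
    next
      case False
      have "odd i"
      proof
        assume "even i"
        with False have "4 \<le> i" by presburger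
        with \<open>even i\<close> show False using that(2) i by blast
      qed
      then show ?thesis using \<open>i \<le> k\<close> False by simp
    qed
  next
    fix i assume "i \<in> (F \<inter> {1, 2}) \<union> odds k"
    then show "i \<in> F" using that(1) kF by (cases "i = k") auto
  qed
  consider "{1, 2} \<subseteq> F" | x y where "x = 1 \<and> y = 2 \<or> x = 2 \<and> y = 1" "x \<in> F" "y \<notin> F" | "1 \<notin> F" "2 \<notin> F"
    by (metis empty_subsetI insert_subset)
  then show ?thesis
  proof cases
    case 1
    show ?thesis
    proof (cases "\<forall>j<k. even j \<longrightarrow> 4 \<le> j \<longrightarrow> j \<in> F")
      case False
      then obtain j where j: "j < k" "even j" "4 \<le> j" "j \<notin> F" by blast
      \<comment> \<open>\<open>?d\<close> contains \<open>j\<close> but not \<open>k\<close>, and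
        \<open>F\<close> contains \<open>k\<close> but not \<open>j\<close>, so the two are
        incomparable sets above \<open>{1}\<close> and \<open>{2}\<close>.\<close>
      let ?d = "{1, 2} \<union> evens j"
      have d: "?d \<in> ?E" using j by (intro early low_set_evens) auto
      have "k \<notin> ?d" "j \<in> ?d" using k3 j by auto
      then have nf: "\<not> F \<subseteq> ?d" "\<not> ?d \<subseteq> F" using kF j by blast+
      show ?thesis by (rule blocked_upper[OF e1 e2 _ _ d nf]) (use 1 in auto)
    next
      case True
      have "\<exists>p\<in>F. odd p \<and> 3 \<le> p"
      proof (rule ccontr)
        assume "\<not> ?thesis"
        moreover have "F \<inter> {1, 2} = {1, 2}" using 1 by blast
        ultimately have "F = {1, 2} \<union> evens k" using evens_eq True by metis
        then show False using assms(2) low_set_evens by metis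
      qed
      then obtain p where p: "p \<in> F" "odd p" "3 \<le> p" by blast
      have "p \<le> k" using p Fk by auto
      have "k \<notin> odds p \<or> k - 1 \<in> F \<and> k - 1 \<notin> odds p"
      proof (cases "p = k")
        case eq: True
        \<comment> \<open>The value \<open>k - 1 = 2\<close> lies below the even chain and is in
          \<open>F\<close> because \<open>{1, 2} \<subseteq> F\<close>.\<close>
        then have "k - 1 = 2 \<or> 4 \<le> k - 1" "even (k - 1)" using p by presburger+
        then have "k - 1 \<in> F" using 1 True k3 by auto
        then show ?thesis using \<open>even (k - 1)\<close> by simp
      qed (use \<open>p \<le> k\<close> in auto)
      then have y: "odds p \<in> ?E" using p \<open>p \<le> k\<close> by (intro early low_set_odds) auto
      show ?thesis
        by (rule blocked_upper_complement[OF e1 e2 _ _ y _ n En(2)[OF y]]) (use 1 p Fn in auto)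
    qed
  next
    \<comment> \<open>By the symmetry between 1 and 2, \<open>x\<close> is the one in
      \<open>F\<close> and \<open>y\<close> the other.\<close>
    case (2 x y)
    have ex: "{x} \<in> ?E" and ey: "{y} \<in> ?E" using 2(1) e1 e2 by auto
    have x_evens: "low_set ({x} \<union> evens m)" and y_evens: "low_set ({y} \<union> evens m)" for m
      using 2(1) low_set_evens[of m] by auto
    have x_odds: "low_set ({x} \<union> odds m)" and y_odds: "low_set ({y} \<union> odds m)" if "3 \<le> m" for m
      using 2(1) low_set_odds[OF that] by auto
    have F12: "F \<inter> {1, 2} = {x}" using 2 by auto
    have xy: "1 \<le> x" "x \<le> 2" "1 \<le> y" "y \<le> 2" "x \<noteq> y" using 2(1) by auto
    show ?thesis
    proof (cases "3 \<in> F")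
      case F3: True
      show ?thesis
      proof (cases "\<forall>j<k. odd j \<longrightarrow> 3 \<le> j \<longrightarrow> j \<in> F")
        case False
        then obtain j where j: "j < k" "odd j" "3 \<le> j" "j \<notin> F" by blast
        then have "3 < k" by simp
        let ?d = "{x} \<union> odds j"
        have d: "?d \<in> ?E" using j xy by (intro early x_odds) auto
        have "k \<notin> ?d" "j \<in> ?d" using k3 j xy by auto
        then have nf: "\<not> F \<subseteq> ?d" "\<not> ?d \<subseteq> F" using kF j by blast+
        show ?thesis
          by (rule blocked_upper[OF ex e3[OF \<open>3 < k\<close>] _ _ d nf]) (use 2 F3 j xy in auto)
      next
        case True
        have "\<exists>p\<in>F. even p \<and> 4 \<le> p"
        proof (rule ccontr)
          assume "\<not> ?thesis"
          then have "F = {x} \<union> odds k" using odds_eq True F12 by metis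
          then show False using assms(2) x_odds k3 by metis
        qed
        then obtain p where p: "p \<in> F" "even p" "4 \<le> p" by blast
        have "p \<le> k" using p Fk by auto
        then have "3 < k" using p by simp
        \<comment> \<open>\<open>?w\<close> meets \<open>F\<close> in \<open>p\<close> and avoids
          \<open>x\<close> and 3, so \<open>F\<close> and the complement of \<open>?w\<close> both
          lie above \<open>{x}\<close> and \<open>{3}\<close>.\<close>
        let ?w = "{y} \<union> evens p"
        have "k \<notin> ?w \<or> k - 1 \<in> F \<and> k - 1 \<notin> ?w"
        proof (cases "p = k")
          case eq: True
          then have "odd (k - 1)" "3 \<le> k - 1" using p by presburger+
          then show ?thesis using True xy k3 by auto
        qed (use \<open>p \<le> k\<close> k3 xy in auto)
        then have w: "?w \<in> ?E" using p \<open>p \<le> k\<close> xy by (intro early y_evens) auto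
        show ?thesis
          by (rule blocked_upper_complement[OF ex e3[OF \<open>3 < k\<close>] _ _ w _ n En(2)[OF w]])
            (use 2 F3 p Fn xy in auto)
      qed
    next
      \<comment> \<open>\<open>F\<close> avoids 3 and \<open>y\<close>, hence it serves as a lower
        element under the complements of \<open>{3}\<close> and \<open>{y}\<close>.\<close>
      case F3: False
      then have "3 < k" using kF k3 by (metis le_neq_implies_less)
      show ?thesis
      proof (cases "\<forall>j<k. even j \<longrightarrow> 4 \<le> j \<longrightarrow> j \<in> F")
        case False
        then obtain j where j: "j < k" "even j" "4 \<le> j" "j \<notin> F" by blast
        let ?b = "{x} \<union> evens j"
        have b: "?b \<in> ?E" using j xy by (intro early x_evens) auto
        have "k \<notin> ?b" "j \<in> ?b" using k3 j xy by auto
        then have nf: "\<not> F \<subseteq> ?b" "\<not> ?b \<subseteq> F" using kF j by blast+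
        show ?thesis
          by (rule blocked_lower[OF e3[OF \<open>3 < k\<close>] ey _ _ b nf _ Fn En(1)[OF b]
                En(1)[OF e3[OF \<open>3 < k\<close>]] En(1)[OF ey]]) (use 2 F3 xy in auto)
      next
        case True
        have "\<exists>p\<in>F. odd p \<and> 3 \<le> p"
        proof (rule ccontr)
          assume "\<not> ?thesis"
          then have "F = {x} \<union> evens k" using evens_eq True F12 by metis
          then show False using assms(2) x_evens by metis
        qed
        then obtain p where p: "p \<in> F" "odd p" "3 \<le> p" by blast
        have "p \<le> k" using p Fk by auto
        \<comment> \<open>\<open>?w\<close> contains \<open>y\<close> and 3, which puts its
          complement below those of \<open>{y}\<close> and \<open>{3}\<close>, and \<open>p\<close>
          lies in \<open>F \<inter> ?w\<close>.\<close>
        let ?w = "{y} \<union> odds p"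
        have "k \<notin> ?w \<or> k - 1 \<in> F \<and> k - 1 \<notin> ?w"
        proof (cases "p = k")
          case eq: True
          then have "even (k - 1)" "4 \<le> k - 1" using p \<open>3 < k\<close> by presburger+
          then show ?thesis using True xy k3 by auto
        qed (use \<open>p \<le> k\<close> k3 xy in auto)
        then have w: "?w \<in> ?E" using p \<open>p \<le> k\<close> xy by (intro early y_odds) auto
        show ?thesis
          by (rule blocked_lower_complement[OF e3[OF \<open>3 < k\<close>] ey _ _ w _ n En(2)[OF w] _ _ Fn
                En(1)[OF w]]) (use 2 F3 p xy in auto)
      qed
    qed
  next
    \<comment> \<open>Throughout this case \<open>F\<close> is a lower element under the complements
      of \<open>{1}\<close> and \<open>{2}\<close>.\<close>
    case 3
    have F12: "F \<inter> {1, 2} = {}" using 3 by auto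
    show ?thesis
    proof (cases "3 \<in> F")
      case F3: True
      show ?thesis
      proof (cases "\<forall>j<k. odd j \<longrightarrow> 3 \<le> j \<longrightarrow> j \<in> F")
        case False
        then obtain j where j: "j < k" "odd j" "3 \<le> j" "j \<notin> F" by blast
        have b: "odds j \<in> ?E" using j by (intro early low_set_odds) auto
        have "k \<notin> odds j" "j \<in> odds j" using j by auto
        then have nf: "\<not> F \<subseteq> odds j" "\<not> odds j \<subseteq> F" using kF j by blast+
        show ?thesis
          by (rule blocked_lower[OF e1 e2 _ _ b nf _ Fn En(1)[OF b] En(1)[OF e1] En(1)[OF e2]])
            (use 3 in auto)
      next
        case True
        have "\<exists>p\<in>F. even p \<and> 4 \<le> p"
        proof (rule ccontr)
          assume "\<not> ?thesis"
          then have "F = {} \<union> odds k" using odds_eq True F12 by metis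
          then show False using assms(2) low_set_odds(1)[OF k3] by simp
        qed
        then obtain p where p: "p \<in> F" "even p" "4 \<le> p" by blast
        have "p \<le> k" using p Fk by auto
        let ?w = "{1, 2} \<union> evens p"
        have "k \<notin> ?w \<or> k - 1 \<in> F \<and> k - 1 \<notin> ?w"
        proof (cases "p = k")
          case eq: True
          then have "odd (k - 1)" "3 \<le> k - 1" using p by presburger+
          then show ?thesis using True k3 by auto
        qed (use \<open>p \<le> k\<close> k3 in auto)
        then have w: "?w \<in> ?E" using p \<open>p \<le> k\<close> by (intro early low_set_evens) auto
        show ?thesis
          by (rule blocked_lower_complement[OF e1 e2 _ _ w _ n En(2)[OF w] _ _ Fn En(1)[OF w]])
            (use 3 p in auto)
      qed
    next
      case F3: False
      then have "3 < k" using kF k3 by (metis le_neq_implies_less)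
      \<comment> \<open>With 1, 2 and 3 all missing from \<open>F\<close>, the set
        \<open>{3}\<close> itself is the incomparable lower partner.\<close>
      note b = e3[OF this]
      have nf: "\<not> F \<subseteq> {3}" "\<not> {3} \<subseteq> F" using kF \<open>3 < k\<close> F3 by auto
      show ?thesis
        by (rule blocked_lower[OF e1 e2 _ _ b nf _ Fn En(1)[OF b] En(1)[OF e1] En(1)[OF e2]])
          (use 3 F3 in auto)
    qed
  qed
qed

section \<open>The greedy output, saturation and the bound\<close>

lemma greedy_colex_butterfly:
  assumes "n \<ge> 3"
  shows "greedy_colex n butterfly = H_family n"
    and "induced_saturating n butterfly (H_family n)"
proof -
  let ?c = "(-) {1..n}"
  \<comment> \<open>Low sets inside \<open>{1..n - 1}\<close> lack \<open>n\<close> and their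
    complements contain it, so the two halves of \<open>H_n\<close> cannot be confused.\<close>
  have low_iff: "F \<in> H_family n \<longleftrightarrow> low_set F" "?c F \<in> H_family n \<longleftrightarrow> low_set F"
    if "F \<subseteq> {1..n - 1}" for F
  proof -
    have cc: "?c (?c F) = F" and "n \<notin> F" using that assms by force+
    show "F \<in> H_family n \<longleftrightarrow> low_set F"
      using that \<open>n \<notin> F\<close> assms unfolding H_family_eq[OF assms] by force
    have nF: "n \<in> ?c F" using \<open>n \<notin> F\<close> assms by simp
    show "?c F \<in> H_family n \<longleftrightarrow> low_set F"
    proof
      assume "?c F \<in> H_family n"
      moreover have "n \<notin> {1..n - 1}" using assms by simp
      then have "\<not> ?c F \<subseteq> {1..n - 1}" using nF by blast
      ultimately obtain Y where Y: "low_set Y" "Y \<subseteq> {1..n - 1}" "?c F = ?c Y"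
        unfolding H_family_eq[OF assms] by blast
      have "?c (?c Y) = Y" using Y(2) by force
      then show "low_set F" using Y(1,3) cc by metis
    next
      assume "low_set F"
      then show "?c F \<in> H_family n" using that unfolding H_family_eq[OF assms] by blast
    qed
  qed
  have sub: "{1..n - 1} \<subseteq> {1..n}" by auto
  then have H: "H_family n \<subseteq> Pow {1..n}" unfolding H_family_eq[OF assms] by blast
  let ?P = "\<lambda>F. {X \<in> H_family n. \<exists>Y. Y \<subseteq> {1..n - 1} \<and> colex_less Y F \<and> (X = Y \<or> X = ?c Y)}"
  have P: "earlier n F \<union> ?c ` earlier n F \<subseteq> ?P F" for F
    using low_iff unfolding earlier_def by blast
  have low: "has_induced_copy butterfly (insert F (?P F))"
    if "F \<subseteq> {1..n - 1}" "F \<notin> H_family n" for F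
    using that low_iff(1)[OF that(1)]
    by (intro has_induced_copy_mono[OF has_induced_copy_insert_earlier insert_mono[OF P]]) simp_all
  \<comment> \<open>The earlier low sets together with their complements are closed under
    complementation, so complementing the copy that blocks \<open>F\<close> yields one that blocks
    \<open>?c F\<close>.\<close>
  have high: "has_induced_copy butterfly (insert (?c F) (?P F))"
    if "F \<subseteq> {1..n - 1}" "?c F \<notin> H_family n" for F
  proof -
    let ?E = "earlier n F"
    have E: "?E \<subseteq> Pow {1..n}" using sub by (auto simp only: earlier_def)
    have "\<not> low_set F" using that low_iff(2) by blast
    have "insert F (?E \<union> ?c ` ?E) \<subseteq> Pow {1..n}" using E sub that(1) by blast
    then have "has_induced_copy butterfly (?c ` insert F (?E \<union> ?c ` ?E))"
      by (rule has_induced_copy_butterfly_complement[OF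
            has_induced_copy_insert_earlier[OF that(1) \<open>\<not> low_set F\<close>]])
    also have "?c ` insert F (?E \<union> ?c ` ?E) = insert (?c F) (?E \<union> ?c ` ?E)"
    proof -
      have "(\<lambda>X. ?c (?c X)) ` ?E = id ` ?E" using E by (intro image_cong) auto
      then show ?thesis by (simp add: image_Un image_image Un_commute)
    qed
    finally show ?thesis by (rule has_induced_copy_mono[OF _ insert_mono[OF P]])
  qed
  show "greedy_colex n butterfly = H_family n"
    by (rule greedy_colex_eqI[OF H_family_free[OF assms] H low high])
  \<comment> \<open>Saturation reuses the blocking copies: the round of \<open>G\<close> is that of
    \<open>G\<close> itself if \<open>n \<notin> G\<close>, and that of \<open>?c G\<close>
    otherwise.\<close>
  have "has_induced_copy butterfly (insert G (H_family n))"
    if G: "G \<subseteq> {1..n}" "G \<notin> H_family n" for G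
  proof (cases "n \<in> G")
    case False
    then have "G \<subseteq> {1..n - 1}" using G(1) by (force simp: le_less)
    from has_induced_copy_mono[OF low[OF this G(2)]] show ?thesis by blast
  next
    case True
    then have 1: "?c G \<subseteq> {1..n - 1}" by (force simp: le_less)
    have 2: "?c (?c G) = G" using G by blast
    from has_induced_copy_mono[OF high[OF 1]] G(2) show ?thesis unfolding 2 by blast
  qed
  then show "induced_saturating n butterfly (H_family n)"
    using H H_family_free[OF assms] by (auto simp: induced_saturating_def)
qed

theorem theorem25:
  fixes n :: nat
  assumes "n \<ge> 3"
  shows "greedy_colex n butterfly = H_family n \<and> sat_star n butterfly \<le> 6 * n - 10"
proof
  show "greedy_colex n butterfly = H_family n" by (rule greedy_colex_butterfly[OF assms])
  have "sat_star n butterfly \<le> card (H_family n)"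
    unfolding sat_star_def using greedy_colex_butterfly(2)[OF assms] by (intro Least_le) blast
  then show "sat_star n butterfly \<le> 6 * n - 10" using card_H_family[OF assms] by linarith
qed

end
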